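(* Consider a multiset $\mathbb{M}=\{M^{(1)},\ldots,M^{(r)}\}$ of interaction matrices (real $N\times N$ matrices) such that all $M\in\mathbb{M}$ fulfill $M^2=cM$ for a constant $c$ with $c<0$. Let the eigenvalues $\mu^*$ of the aggregated matrix $M^*=\frac1r\sum_{\ell=1}^r M^{(\ell)}$ be bounded by $c\le\mu^*<0$. For a time window of length $\tau>0$, let $\hat M=\tau^{-1}\ln\left(\frac1r\sum_{\ell=1}^r\exp(\tau M^{(\ell)})\right)$ be the effective temporal matrix, whose eigenvalues are $\hat\mu=\tau^{-1}\ln\left(1+\frac{e^{c\tau}-1}{c}\,\mu^*\right)$. Then the temporal dynamics $\dot x=\hat M x$ are slower than the aggregate dynamics $\dot x=M^*x$, i.e. $\mu^*<\hat\mu$. Moreover, as $\tau\to0$, the temporal dynamics converge to the aggregate dynamics, i.e. $\hat\mu\to\mu^*$.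
   Context: $\ln$ of a matrix denotes the matrix logarithm. The temporal dynamics model a system in which one interaction matrix is drawn uniformly at random from the multiset $\mathbb{M}$ and is active during a time window of length $\tau$: the expected state after this window is $\frac1r\sum_{\ell=1}^r\exp(\tau M^{(\ell)})x(0)$, which equals the state at time $\tau$ of the constant linear system $\dot x=\hat M x$. The aggregate dynamics are the static system $\dot x=M^*x$ in which all interactions are averaged. The matrices $M^*$ and $\hat M$ have the same eigenspaces, and each eigenvalue $\mu^*$ of $M^*$ corresponds to the eigenvalue $\hat\mu=\tau^{-1}\ln\left(1+\frac{e^{c\tau}-1}{c}\mu^*\right)$ of $\hat M$. Convergence speed is measured by these eigenvalues: an eigenvalue that is negative and closer to $0$ means slower relaxation.
   Formalization: The strict inequality μ* < μ̂ is proved for c < μ* < 0 only; at the endpoint μ* = c it fails (e.g. N = r = 1, M = (c) gives μ̂ = c), and there the equality μ̂ = μ* is proved instead. *)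

theory Defs
  imports "HOL-Analysis.Analysis" "HOL-Library.Multiset"
begin

text \<open>
  Eigenvalues of a real matrix are taken over the complex numbers, because the interaction
  matrices (and hence their average) need not be symmetric.
\<close>

definition complex_eigenspace :: "real^'n^'n \<Rightarrow> complex \<Rightarrow> (complex^'n) set" where
  "complex_eigenspace A z = {v. map_matrix complex_of_real A *v v = z *s v}"

definition complex_eigenvalue :: "real^'n^'n \<Rightarrow> complex \<Rightarrow> bool" where
  "complex_eigenvalue A z \<longleftrightarrow> (\<exists>v. v \<noteq> 0 \<and> v \<in> complex_eigenspace A z)"

text \<open>
  The constants \<open>exp\<close> and \<open>(^)\<close> of the library do not refer to the matrix product on the
  type \<open>real^'n^'n\<close>.
\<close>

definition matrix_power :: "real^'n^'n \<Rightarrow> nat \<Rightarrow> real^'n^'n" where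
  "matrix_power A k = (((**) A) ^^ k) (mat 1)"

definition matrix_exp :: "real^'n^'n \<Rightarrow> real^'n^'n" where
  "matrix_exp A = (\<Sum>k. (1 / fact k) *\<^sub>R matrix_power A k)"

text \<open>
  The principal logarithm: the logarithm whose eigenvalues all lie in the open strip
  \<open>-pi < Im z < pi\<close>. It exists and is unique (and is real for a real matrix) when no
  eigenvalue of the argument lies in \<open>(-\<infinity>, 0]\<close>; otherwise there is no such
  logarithm and \<open>matrix_ln\<close> is unspecified.
\<close>

definition is_principal_log :: "real^'n^'n \<Rightarrow> real^'n^'n \<Rightarrow> bool" where
  "is_principal_log A X \<longleftrightarrow>
     matrix_exp X = A \<and> (\<forall>z. complex_eigenvalue X z \<longrightarrow> - pi < Im z \<and> Im z < pi)"

definition matrix_ln :: "real^'n^'n \<Rightarrow> real^'n^'n" where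
  "matrix_ln A = (THE X. is_principal_log A X)"

definition aggregate_matrix :: "(real^'n^'n) multiset \<Rightarrow> real^'n^'n" where
  "aggregate_matrix MM = (1 / real (size MM)) *\<^sub>R (\<Sum>M\<in>#MM. M)"

definition temporal_matrix :: "real \<Rightarrow> (real^'n^'n) multiset \<Rightarrow> real^'n^'n" where
  "temporal_matrix \<tau> MM =
     (1 / \<tau>) *\<^sub>R matrix_ln ((1 / real (size MM)) *\<^sub>R (\<Sum>M\<in>#MM. matrix_exp (\<tau> *\<^sub>R M)))"

definition temporal_eigenvalue :: "real \<Rightarrow> real \<Rightarrow> real \<Rightarrow> real" where
  "temporal_eigenvalue c \<tau> \<mu> = (1 / \<tau>) * ln (1 + (exp (c * \<tau>) - 1) / c * \<mu>)"

end

theory Submission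
  imports Defs "HOL-Computational_Algebra.Fundamental_Theorem_Algebra"
begin

text \<open>
  Since \<open>M\<^sup>2 = c M\<close>, the exponential series collapses to
  \<open>exp (\<tau> M) = 1 + k M\<close> with \<open>k = (exp (c \<tau>) - 1) / c\<close>, so the averaged propagator is
  \<open>1 + k M*\<close>, whose eigenvalues \<open>1 + k \<mu>\<close> lie in \<open>(0, 1)\<close>. It need not be diagonalizable, so
  existence, uniqueness and the eigenspaces of its principal logarithm are obtained without a
  normal form. With \<open>N = k M*\<close>, a logarithm is the integral of \<open>N (1 + s N)\<^sup>-\<^sup>1\<close> over
  \<open>s \<in> [0, 1]\<close>; on a common eigenvector with \<open>N\<close> it acts as the real number \<open>ln (1 + \<nu>)\<close>.
  Conversely, if \<open>exp X Z = Z exp Y\<close> and no eigenvalues of \<open>X\<close> and \<open>Y\<close> differ by a nonzero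
  multiple of \<open>2 \<pi> i\<close>, then \<open>X Z = Z Y\<close>: for \<open>Z = 1\<close> this is uniqueness of the logarithm,
  for scalar \<open>Y\<close> it identifies the eigenspaces of \<open>X\<close> with those of \<open>exp X\<close>. The strict
  inequality for \<open>c < \<mu> < 0\<close> is strict convexity of \<open>exp\<close>, and the limit is the derivative of
  \<open>\<tau> \<mapsto> ln (1 + k \<mu>)\<close> at \<open>0\<close>.
\<close>

subsection \<open>Exponentials in Banach algebras\<close>

lemma exp_mult_intertwine:
  fixes X Y Z :: "'a::{real_normed_algebra_1,banach}"
  assumes "X * Z = Z * Y"
  shows "exp X * Z = Z * exp Y"
proof -
  have p: "X ^ n * Z = Z * Y ^ n" for n
    by (induction n) (simp_all add: assms mult.assoc flip: power_Suc2, simp add: power_Suc2 assms flip: mult.assoc)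
  have "(\<lambda>n. (X ^ n /\<^sub>R fact n) * Z) sums (exp X * Z)"
    by (rule sums_mult2[OF exp_converges])
  moreover have "(\<lambda>n. Z * (Y ^ n /\<^sub>R fact n)) sums (Z * exp Y)"
    by (rule sums_mult[OF exp_converges])
  ultimately show ?thesis
    by (simp add: p sums_unique2)
qed

text \<open>For T Z = X Z - Z Y the hypotheses read T Z = W and T W = 0, so X^n Z expands to Z Y^n +
  n W Y^(n-1) with no further terms. Dividing by n! turns the second part into the series of W exp
  Y.\<close>

lemma exp_mult_intertwine_nilpotent:
  fixes X Y Z W :: "'a::{real_normed_algebra_1,banach}"
  assumes Z: "X * Z = Z * Y + W" and W: "X * W = W * Y"
  shows "exp X * Z = (Z + W) * exp Y"
proof -
  have WX: "X * (W * Y ^ n) = W * Y ^ Suc n" for n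
    by (simp add: W flip: mult.assoc)
  have p: "X ^ Suc n * Z = Z * Y ^ Suc n + of_nat (Suc n) *\<^sub>R (W * Y ^ n)" for n
  proof (induction n)
    case 0
    then show ?case by (simp add: Z)
  next
    case (Suc n)
    have "X ^ Suc (Suc n) * Z = X * (X ^ Suc n * Z)"
      by (simp add: mult.assoc)
    also have "\<dots> = (X * Z) * Y ^ Suc n + of_nat (Suc n) *\<^sub>R (X * (W * Y ^ n))"
      unfolding Suc.IH by (simp add: distrib_left mult.assoc)
    also have "\<dots> = Z * Y ^ Suc (Suc n) + of_nat (Suc (Suc n)) *\<^sub>R (W * Y ^ Suc n)"
      unfolding WX Z by (simp add: algebra_simps scaleR_2)
    finally show ?case .
  qed
  \<comment> \<open>The series start at index 1, so that the exponent n - 1 is a genuine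
    predecessor.\<close>
  have "(\<lambda>n. (X ^ Suc n /\<^sub>R fact (Suc n)) * Z) sums ((exp X - 1) * Z)"
    using exp_converges[of X] sums_Suc_iff[of "\<lambda>n. X ^ n /\<^sub>R fact n" "exp X - 1"]
    by (intro sums_mult2) simp
  moreover have "(\<lambda>n. Z * (Y ^ Suc n /\<^sub>R fact (Suc n)) + W * (Y ^ n /\<^sub>R fact n)) sums
      (Z * (exp Y - 1) + W * exp Y)"
    using exp_converges[of Y] sums_Suc_iff[of "\<lambda>n. Y ^ n /\<^sub>R fact n" "exp Y - 1"]
    by (intro sums_add sums_mult exp_converges) simp
  moreover have "(X ^ Suc n /\<^sub>R fact (Suc n)) * Z =
      Z * (Y ^ Suc n /\<^sub>R fact (Suc n)) + W * (Y ^ n /\<^sub>R fact n)" for n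
  proof -
    have "(X ^ Suc n /\<^sub>R fact (Suc n)) * Z = (X ^ Suc n * Z) /\<^sub>R fact (Suc n)"
      by simp
    also have "\<dots> = Z * (Y ^ Suc n /\<^sub>R fact (Suc n)) +
        (inverse (fact (Suc n)) * of_nat (Suc n)) *\<^sub>R (W * Y ^ n)"
      unfolding p by (simp add: scaleR_right_distrib)
    also have "inverse (fact (Suc n)) * of_nat (Suc n) = inverse (fact n :: real)"
      by (simp add: nonzero_inverse_mult_distrib del: of_nat_Suc)
    finally show ?thesis by simp
  qed
  ultimately have "(exp X - 1) * Z = Z * (exp Y - 1) + W * exp Y"
    by (simp only: sums_unique2)
  then show ?thesis by (simp add: algebra_simps)
qed

text \<open>Beyond the first two terms, (n + 2)! >= n! bounds the remainder by |y|^2 exp |y|, which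
  is o(|y|).\<close>

lemma exp_has_derivative_at_0:
  "((exp :: 'a::{real_normed_algebra_1,banach} \<Rightarrow> 'a) has_derivative (\<lambda>h. h)) (at 0)"
proof (rule has_derivativeI_sandwich[of 1])
  show "bounded_linear (\<lambda>h::'a. h)" by (rule bounded_linear_ident)
  show "norm (exp y - exp 0 - (y - 0)) / norm (y - 0) \<le> norm y * exp (norm y)"
    if "y \<noteq> 0" for y :: 'a
  proof -
    have s: "summable (\<lambda>n. norm y ^ 2 * (norm y ^ n / fact n))"
      using summable_exp_generic[of "norm y"] by (intro summable_mult) (simp add: field_simps)
    have e: "suminf (\<lambda>n. norm y ^ 2 * (norm y ^ n / fact n)) = norm y ^ 2 * exp (norm y)"
      using exp_converges[of "norm y"]
      by (intro sums_unique[symmetric] sums_mult) (simp add: field_simps)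
    have b: "norm (y ^ (n + 2) /\<^sub>R fact (n + 2)) \<le> norm y ^ 2 * (norm y ^ n / fact n)" for n
    proof -
      have "norm (y ^ (n + 2) /\<^sub>R fact (n + 2)) = norm (y ^ (n + 2)) / fact (n + 2)"
        by (simp add: divide_inverse mult.commute del: fact_Suc)
      also have "\<dots> \<le> norm y ^ (n + 2) / fact n"
        by (intro frac_le norm_power_ineq fact_mono) auto
      also have "\<dots> = norm y ^ 2 * (norm y ^ n / fact n)"
        by (simp add: power2_eq_square mult.assoc)
      finally show ?thesis .
    qed
    have "norm (exp y - 1 - y) = norm (\<Sum>n. y ^ (n + 2) /\<^sub>R fact (n + 2))"
      by (simp add: exp_first_two_terms)
    also have "\<dots> \<le> norm y ^ 2 * exp (norm y)"
      unfolding e[symmetric] by (rule norm_suminf_le[OF b s])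
    finally show ?thesis using that by (simp add: divide_simps power2_eq_square mult_ac)
  qed
  show "((\<lambda>y::'a. norm y * exp (norm y)) \<longlongrightarrow> 0) (at 0)"
    by (auto intro!: tendsto_eq_intros)
qed auto

text \<open>The resolvent identity R t - R s = (s - t) R t N R s gives continuity once R t is
  bounded near s.\<close>

lemma continuous_on_inverse_pencil:
  fixes N :: "'a::{real_normed_algebra_1}"
  assumes R: "\<And>s. s \<in> S \<Longrightarrow> R s * (1 + s *\<^sub>R N) = 1" "\<And>s. s \<in> S \<Longrightarrow> (1 + s *\<^sub>R N) * R s = 1"
  shows "continuous_on S R"
proof -
  have res: "R t - R s = (s - t) *\<^sub>R (R t * N * R s)" if "s \<in> S" "t \<in> S" for s t
  proof -
    have "R t - R s = R t * ((1 + s *\<^sub>R N) * R s) - (R t * (1 + t *\<^sub>R N)) * R s"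
      using R that by simp
    also have "\<dots> = (s - t) *\<^sub>R (R t * N * R s)"
      by (simp add: algebra_simps)
    finally show ?thesis .
  qed
  have "(R \<longlongrightarrow> R s) (at s within S)" if s: "s \<in> S" for s
  proof -
    define K where "K = norm N * norm (R s)"
    have K: "K \<ge> 0" by (simp add: K_def)
    have d: "norm (R t - R s) \<le> \<bar>s - t\<bar> * (norm (R t) * K)" if "t \<in> S" for t
    proof -
      have "norm (R t * N * R s) \<le> norm (R t) * K"
        by (metis K_def mult.assoc mult_left_mono norm_ge_zero norm_mult_ineq order_trans)
      then show ?thesis unfolding res[OF s that] by (simp add: mult_left_mono)
    qed
    \<comment> \<open>For t close to s the difference is at most half of |R t|. Absorbing it gives
      |R t| <= 2 |R s|, a bound free of t.\<close>
    have small: "norm (R t - R s) \<le> \<bar>s - t\<bar> * (2 * norm (R s) * K)"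
      if "t \<in> S" "\<bar>s - t\<bar> * K \<le> 1/2" for t
    proof -
      have "norm (R t) \<le> norm (R s) + norm (R t - R s)"
        using norm_triangle_ineq[of "R s" "R t - R s"] by simp
      also have "norm (R t - R s) \<le> 1/2 * norm (R t)"
        using d[OF that(1)] mult_right_mono[OF that(2) norm_ge_zero[of "R t"]] by (simp add: mult_ac)
      finally have "norm (R t) \<le> 2 * norm (R s)" by simp
      then have "\<bar>s - t\<bar> * (norm (R t) * K) \<le> \<bar>s - t\<bar> * (2 * norm (R s) * K)"
        using K by (intro mult_left_mono mult_right_mono) auto
      with d[OF that(1)] show ?thesis by linarith
    qed
    have "((\<lambda>t. \<bar>s - t\<bar> * K) \<longlongrightarrow> \<bar>s - s\<bar> * K) (at s within S)"
      by (intro tendsto_intros)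
    then have "\<forall>\<^sub>F t in at s within S. \<bar>s - t\<bar> * K < 1/2"
      by (rule order_tendstoD) simp
    then have "\<forall>\<^sub>F t in at s within S. norm (R t - R s) \<le> \<bar>s - t\<bar> * (2 * norm (R s) * K)"
      by (simp add: eventually_at_filter) (elim eventually_mono, use small in auto)
    moreover have "((\<lambda>t. \<bar>s - t\<bar> * (2 * norm (R s) * K)) \<longlongrightarrow> 0) (at s within S)"
      by (rule tendsto_eq_intros refl | simp)+
    ultimately have "((\<lambda>t. R t - R s) \<longlongrightarrow> 0) (at s within S)"
      by (rule Lim_null_comparison)
    then show ?thesis by (simp add: LIM_zero_iff)
  qed
  then show ?thesis by (simp add: continuous_on_def)
qed

text \<open>
  With \<open>F t = integral {0..t} (\<lambda>s. N * R s)\<close>, the function \<open>exp (- F t) * (1 + t *\<^sub>R N)\<close> has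
  derivative \<open>0\<close>, hence is constantly \<open>1\<close>.
\<close>

lemma exp_integral_log:
  fixes N :: "'a::{real_normed_algebra_1,banach}"
  assumes R: "\<And>s. s \<in> {0..1} \<Longrightarrow> R s * (1 + s *\<^sub>R N) = 1"
    "\<And>s. s \<in> {0..1} \<Longrightarrow> (1 + s *\<^sub>R N) * R s = 1"
  shows "\<exists>X. ((\<lambda>s. N * R s) has_integral X) {0..1} \<and> X * N = N * X \<and> exp X = 1 + N"
proof -
  define G where "G s = N * R s" for s
  define F where "F s = integral {0..s} G" for s
  have cG: "continuous_on {0..1} G"
    unfolding G_def by (intro continuous_intros continuous_on_inverse_pencil[OF R]) auto
  \<comment> \<open>An inverse commutes with whatever commutes with the original. Hence all values
    of \<open>G\<close>, and then of its integrals \<open>F\<close>, commute with each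
    other.\<close>
  have RC: "C * R s = R s * C" if "s \<in> {0..1}" "C * N = N * C" for C s
  proof -
    have "(1 + s *\<^sub>R N) * C = C * (1 + s *\<^sub>R N)"
      using that(2) by (simp add: algebra_simps)
    then have "R s * ((1 + s *\<^sub>R N) * C) * R s = R s * (C * (1 + s *\<^sub>R N)) * R s"
      by simp
    then show ?thesis
      using R[OF that(1)] by (metis mult.assoc mult_1_left mult_1_right)
  qed
  have GN: "G s * N = N * G s" if "s \<in> {0..1}" for s
    using RC[OF that, of N] by (simp add: G_def flip: mult.assoc)
  have GG: "G s * G t = G t * G s" if "s \<in> {0..1}" "t \<in> {0..1}" for s t
  proof -
    have "G t * R s = R s * G t" by (rule RC) (use that GN in auto)
    then show ?thesis
      using GN[OF that(2)] by (simp add: G_def) (metis mult.assoc)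
  qed
  have G_int: "G integrable_on {0..t}" if "t \<in> {0..1}" for t
    by (rule integrable_continuous_real, rule continuous_on_subset[OF cG]) (use that in auto)
  have FC: "C * F t = F t * C" if t: "t \<in> {0..1}" and C: "\<And>s. s \<in> {0..1} \<Longrightarrow> C * G s = G s * C" for C t
  proof -
    have i: "(G has_integral F t) {0..t}"
      using G_int[OF t] by (simp add: F_def integrable_integral)
    have "((\<lambda>s. C * G s) has_integral C * F t) {0..t}"
      by (rule has_integral_mult_right[OF i])
    moreover have "((\<lambda>s. G s * C) has_integral F t * C) {0..t}"
      by (rule has_integral_mult_left[OF i])
    then have "((\<lambda>s. C * G s) has_integral F t * C) {0..t}"
      by (rule has_integral_eq[rotated]) (use t C in auto)
    ultimately show ?thesis by (rule has_integral_unique)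
  qed
  have FF: "F s * F t = F t * F s" if "s \<in> {0..1}" "t \<in> {0..1}" for s t
    by (rule FC[OF that(2)]) (use that FC GG in metis)
  have FD: "(F has_vector_derivative G s) (at s within {0..1})" if "s \<in> {0..1}" for s
    unfolding F_def by (rule integral_has_vector_derivative[OF cG that])
  define H where "H t = exp (- F t) * (1 + t *\<^sub>R N)" for t
  have HD: "(H has_vector_derivative 0) (at s within {0..1})" if s: "s \<in> {0..1}" for s
  proof -
    \<comment> \<open>Splitting exp (- F t) = exp (- F s) exp (F s - F t) moves the argument of the
      varying factor to 0 at t = s, where the derivative of \<open>exp\<close> is the
      identity.\<close>
    have "((\<lambda>t. F s - F t) has_derivative (\<lambda>h. - (h *\<^sub>R G s))) (at s within {0..1})"
      using FD[OF s] by (auto intro!: derivative_eq_intros simp: has_vector_derivative_def)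
    then have "((\<lambda>t. exp (F s - F t)) has_derivative (\<lambda>h. - (h *\<^sub>R G s))) (at s within {0..1})"
      by (rule has_derivative_compose) (simp add: exp_has_derivative_at_0)
    then have e: "((\<lambda>t. exp (F s - F t)) has_vector_derivative - G s) (at s within {0..1})"
      by (simp add: has_vector_derivative_def)
    have l: "((\<lambda>t. 1 + t *\<^sub>R N) has_vector_derivative N) (at s within {0..1})"
      by (auto intro!: derivative_eq_intros)
    have "((\<lambda>t. exp (- F s) * (exp (F s - F t) * (1 + t *\<^sub>R N))) has_vector_derivative
       exp (- F s) * (exp (F s - F s) * N + - G s * (1 + s *\<^sub>R N))) (at s within {0..1})"
      by (intro has_vector_derivative_mult_right has_vector_derivative_mult e l)
    moreover have "G s * (1 + s *\<^sub>R N) = N"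
      using R(1)[OF s] by (simp add: G_def mult.assoc)
    moreover have Heq: "H t = exp (- F s) * (exp (F s - F t) * (1 + t *\<^sub>R N))" if "t \<in> {0..1}" for t
    proof -
      have "exp (- F s + (F s - F t)) = exp (- F s) * exp (F s - F t)"
        by (rule exp_add_commuting) (use FF[OF s that] in \<open>simp add: algebra_simps\<close>)
      then show ?thesis by (simp add: H_def mult.assoc)
    qed
    ultimately show ?thesis
      by (intro has_vector_derivative_transform[OF s Heq]) simp_all
  qed
  have "H 1 = H 0"
    using has_vector_derivative_zero_constant[of "{0..1}" H] HD
    by (metis atLeastAtMost_iff convex_real_interval(5) order_refl zero_le_one)
  then have "exp (F 1) * (exp (- F 1) * (1 + N)) = exp (F 1)"
    by (simp add: H_def F_def)
  then have "exp (F 1) = 1 + N"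
    by (simp add: exp_minus_inverse flip: mult.assoc)
  moreover have "(G has_integral F 1) {0..1}"
    using G_int[of 1] by (simp add: F_def integrable_integral)
  moreover have "F 1 * N = N * F 1"
    using FC[of 1 N] GN by simp
  ultimately show ?thesis unfolding G_def by blast
qed

text \<open>All positive powers of X are multiples of X: X^(n+1) = d^n X. The coefficient of X is
  therefore the scalar exponential series without its constant term, divided by d.\<close>

lemma exp_quasi_idempotent:
  fixes X :: "'a::{real_normed_algebra_1,banach}"
  assumes "X * X = d *\<^sub>R X" "d \<noteq> 0"
  shows "exp X = 1 + ((exp d - 1) / d) *\<^sub>R X"
proof -
  have p: "X ^ Suc n = d ^ n *\<^sub>R X" for n
    by (induction n) (simp_all add: assms(1) mult.commute)
  have "(\<lambda>n. X ^ Suc n /\<^sub>R fact (Suc n)) sums (exp X - 1)"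
    using exp_converges[of X] sums_Suc_iff[of "\<lambda>n. X ^ n /\<^sub>R fact n" "exp X - 1"] by simp
  moreover have "(\<lambda>n. d ^ Suc n /\<^sub>R fact (Suc n)) sums (exp d - 1)"
    using exp_converges[of d] sums_Suc_iff[of "\<lambda>n. d ^ n /\<^sub>R fact n" "exp d - 1"] by simp
  then have "(\<lambda>n. ((d ^ Suc n /\<^sub>R fact (Suc n)) / d) *\<^sub>R X) sums (((exp d - 1) / d) *\<^sub>R X)"
    by (intro sums_scaleR_left sums_divide)
  moreover have "((d ^ Suc n /\<^sub>R fact (Suc n)) / d) *\<^sub>R X = X ^ Suc n /\<^sub>R fact (Suc n)" for n
    unfolding p using assms(2) by simp
  ultimately have "exp X - 1 = ((exp d - 1) / d) *\<^sub>R X"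
    by (simp only: sums_unique2)
  then show ?thesis by (simp add: algebra_simps)
qed

subsection \<open>Annihilating products and eigenvectors\<close>

lemma span_image_lessThan:
  fixes u :: "nat \<Rightarrow> 'a::real_vector"
  assumes "x \<in> span (u ` {..<m})"
  shows "\<exists>c. x = (\<Sum>k<m. c k *\<^sub>R u k)"
  using assms
proof (induction m arbitrary: x)
  case 0
  then show ?case by simp
next
  case (Suc m)
  then obtain r where "x - r *\<^sub>R u m \<in> span (u ` {..<m})"
    by (auto simp: lessThan_Suc span_insert)
  then obtain c where "x - r *\<^sub>R u m = (\<Sum>k<m. c k *\<^sub>R u k)"
    using Suc.IH by blast
  then have "x = (\<Sum>k<Suc m. (c(m := r)) k *\<^sub>R u k)"
    by (simp add: algebra_simps)
  then show ?case by blast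
qed

text \<open>Otherwise every initial segment of the sequence is independent, and its image under
  \<open>g\<close> exceeds the dimension of the Euclidean target. The injection \<open>g\<close>
  supplies finite dimension without an inner product on \<open>'a\<close>.\<close>

lemma finite_dimensional_dependence:
  fixes u :: "nat \<Rightarrow> 'a::real_vector" and g :: "'a \<Rightarrow> 'b::euclidean_space"
  assumes g: "linear g" "inj g"
  shows "\<exists>m c. u m = (\<Sum>k<m. c k *\<^sub>R u k)"
proof (rule ccontr)
  assume "\<not> ?thesis"
  then have *: "u m \<notin> span (u ` {..<m})" for m
    using span_image_lessThan by metis
  have ind: "independent (u ` {..<m}) \<and> card (u ` {..<m}) = m" for m
  proof (induction m)
    case 0
    then show ?case by (simp add: independent_empty)
  next
    case (Suc m)
    have "u m \<notin> u ` {..<m}" using *[of m] span_base by metis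
    with Suc show ?case
      by (simp add: lessThan_Suc independent_insert *)
  qed
  let ?B = "u ` {..<Suc DIM('b)}"
  have "independent (g ` ?B)"
    using ind g by (intro linear_independent_injective_image) (auto intro: inj_on_subset)
  then have "card (g ` ?B) \<le> DIM('b)"
    using independent_bound by blast
  moreover have "card (g ` ?B) = card ?B"
    by (intro card_image inj_on_subset[OF g(2)]) simp
  ultimately show False using ind by simp
qed

text \<open>The iterates of \<open>f\<close> on \<open>x\<close> are dependent, so some nonzero
  polynomial in \<open>f\<close> kills \<open>x\<close>; over the complex numbers it splits into
  linear factors. Complex scaling is the parameter \<open>s\<close>, because the type class provides
  real scaling only.\<close>

lemma annihilating_factors:
  fixes f :: "'a::real_vector \<Rightarrow> 'a" and s :: "complex \<Rightarrow> 'a \<Rightarrow> 'a"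
    and g :: "'a \<Rightarrow> 'b::euclidean_space"
  assumes s: "vector_space s" "\<And>r x. s (of_real r) x = r *\<^sub>R x"
    and f: "\<And>x y. f (x + y) = f x + f y" "\<And>a x. f (s a x) = s a (f x)"
    and g: "linear g" "inj g"
  shows "\<exists>as. fold (\<lambda>a y. f y - s a y) as x = 0"
proof -
  interpret vector_space s by (rule s(1))
  have fk: "(f ^^ k) (y - s a z) = (f ^^ k) y - s a ((f ^^ k) z)" for k y z a
  proof -
    have m: "(f ^^ k) (s b v) = s b ((f ^^ k) v)" for b v
      by (induction k) (simp_all add: f)
    have "(f ^^ k) (v + w) = (f ^^ k) v + (f ^^ k) w" for v w
      by (induction k) (simp_all add: f)
    from this[of y "s (- a) z"] show ?thesis using m[of "- a" z] by simp
  qed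
  \<comment> \<open>This is p(f) y. The strict degree bound \<open>n\<close> is what the induction
    runs on; each root split off lowers it by one.\<close>
  define P where "P p n y = (\<Sum>k<n. s (coeff p k) ((f ^^ k) y))" for p n y
  have factors: "\<exists>as. fold (\<lambda>a y. f y - s a y) as y = 0"
    if "degree p < n" "p \<noteq> 0" "P p n y = 0" for p n y
    using that
  proof (induction n arbitrary: p y)
    case 0
    then show ?case by simp
  next
    case (Suc n)
    show ?case
    proof (cases "degree p = 0")
      case True
      then obtain c where c: "p = [:c:]" by (rule degree_eq_zeroE)
      have "P p (Suc n) y = s c y"
        unfolding P_def c by (subst sum.lessThan_Suc_shift) simp
      then have "y = 0" using Suc.prems c by simp
      then show ?thesis by (intro exI[of _ "[]"]) simp
    next
      case False
      then have "\<not> constant (poly p)" by (simp add: constant_degree)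
      then obtain a where "poly p a = 0"
        using fundamental_theorem_of_algebra by blast
      then obtain q where q: "p = [:- a, 1:] * q"
        by (metis poly_eq_0_iff_dvd dvdE)
      then have q0: "q \<noteq> 0" using Suc.prems by auto
      have "degree p = Suc (degree q)"
        unfolding q using q0 by (subst degree_mult_eq) auto
      then have dq: "degree q < n" using Suc.prems by simp
      \<comment> \<open>Multiplying by [:- a, 1:] shifts the coefficients of \<open>q\<close> and
        subtracts a times them, whence p(f) y = q(f) (f y - a y).\<close>
      have co: "coeff p k = (if k = 0 then 0 else coeff q (k - 1)) - a * coeff q k" for k
        by (cases k) (simp_all add: q coeff_pCons)
      have "P p (Suc n) y = (\<Sum>k<n. s (coeff q k) ((f ^^ Suc k) y)) - (\<Sum>k<Suc n. s (a * coeff q k) ((f ^^ k) y))"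
        unfolding P_def co scale_left_diff_distrib sum_subtractf
        by (subst sum.lessThan_Suc_shift) simp
      also have "\<dots> = (\<Sum>k<n. s (coeff q k) ((f ^^ Suc k) y)) - (\<Sum>k<n. s (a * coeff q k) ((f ^^ k) y))"
        using dq by (simp add: coeff_eq_0)
      also have "\<dots> = P q n (f y - s a y)"
        unfolding P_def fk by (simp add: scale_right_diff_distrib sum_subtractf funpow_swap1 mult.commute)
      finally have "P q n (f y - s a y) = 0" using Suc.prems by simp
      then obtain as where "fold (\<lambda>a y. f y - s a y) as (f y - s a y) = 0"
        using Suc.IH[OF dq q0] by blast
      then have "fold (\<lambda>a y. f y - s a y) (a # as) y = 0" by simp
      then show ?thesis by blast
    qed
  qed
  obtain m c where m: "(f ^^ m) x = (\<Sum>k<m. c k *\<^sub>R (f ^^ k) x)"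
    using finite_dimensional_dependence[OF g, of "\<lambda>k. (f ^^ k) x"] by blast
  \<comment> \<open>The monic polynomial of the dependence; its leading coefficient 1 makes it
    nonzero.\<close>
  define p where "p = monom 1 m - (\<Sum>k<m. monom (complex_of_real (c k)) k)"
  have cp: "coeff p k = (if k = m then 1 else if k < m then - of_real (c k) else 0)" for k
    by (auto simp: p_def coeff_sum)
  have "degree p < Suc m"
    by (simp add: less_Suc_eq_le degree_le cp)
  moreover have "p \<noteq> 0" using cp[of m] by auto
  moreover have "P p (Suc m) x = 0"
    by (simp add: P_def cp s(2) m sum_negf)
  ultimately show ?thesis by (rule factors)
qed

text \<open>Apply the factors in turn. The last vector before the product first vanishes is nonzero,
  still satisfies \<open>P\<close>, and is killed by the next factor.\<close>

lemma eigenvector_in_invariant_set: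
  fixes f :: "'a::ab_group_add \<Rightarrow> 'a"
  assumes "fold (\<lambda>a y. f y - s a y) as x = 0" "x \<noteq> 0" "P x" "\<And>a y. P y \<Longrightarrow> P (f y - s a y)"
  shows "\<exists>a y. y \<noteq> 0 \<and> P y \<and> f y = s a y"
  using assms(1-3)
proof (induction as arbitrary: x)
  case (Cons a as)
  show ?case
  proof (cases "f x - s a x = 0")
    case False
    with Cons assms(4) show ?thesis by simp
  qed (use Cons in auto)
qed simp

subsection \<open>The Banach algebra of complex matrices\<close>

text \<open>
  The library's \<open>exp\<close> is available on a Banach algebra. On \<open>complex^'n^'n\<close> the type-class
  product is componentwise, so the matrix product needs a type of its own; the operator norm is
  chosen because the class requires \<open>norm 1 = 1\<close>.
\<close>

typedef 'n::finite cmat = "UNIV :: (complex^'n^'n) set"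
  morphisms mat_of cmat_of ..

setup_lifting type_definition_cmat

instantiation cmat :: (finite) real_normed_algebra_1
begin

lift_definition zero_cmat :: "'a cmat" is 0 .
lift_definition one_cmat :: "'a cmat" is "mat 1" .
lift_definition plus_cmat :: "'a cmat \<Rightarrow> 'a cmat \<Rightarrow> 'a cmat" is "(+)" .
lift_definition minus_cmat :: "'a cmat \<Rightarrow> 'a cmat \<Rightarrow> 'a cmat" is "(-)" .
lift_definition uminus_cmat :: "'a cmat \<Rightarrow> 'a cmat" is "uminus" .
lift_definition times_cmat :: "'a cmat \<Rightarrow> 'a cmat \<Rightarrow> 'a cmat" is "(**)" .
lift_definition scaleR_cmat :: "real \<Rightarrow> 'a cmat \<Rightarrow> 'a cmat" is "scaleR" .
lift_definition norm_cmat :: "'a cmat \<Rightarrow> real" is "\<lambda>A. onorm ((*v) A)" .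
definition "dist_cmat (A :: 'a cmat) B = norm (A - B)"
definition "sgn_cmat (A :: 'a cmat) = scaleR (inverse (norm A)) A"
definition "(uniformity :: ('a cmat \<times> 'a cmat) filter) =
  (INF e\<in>{0 <..}. principal {(x, y). dist x y < e})"
definition "open_cmat (U :: 'a cmat set) \<longleftrightarrow>
  (\<forall>x\<in>U. \<forall>\<^sub>F (x', y) in uniformity. x' = x \<longrightarrow> y \<in> U)"

instance
proof
  fix A B C :: "'a cmat" and r :: real
  show "A * B * C = A * (B * C)" by transfer (simp add: matrix_mul_assoc)
  show "(A + B) * C = A * C + B * C"
    by transfer (simp add: matrix_matrix_mult_def vec_eq_iff distrib_right sum.distrib)
  show "A * (B + C) = A * B + A * C" by transfer (simp add: matrix_add_ldistrib)
  show "1 * A = A" "A * 1 = A" by (transfer; simp)+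
  show "(0 :: 'a cmat) \<noteq> 1" by transfer (simp add: vec_eq_iff mat_def zero_neq_one)
  show "r *\<^sub>R A * B = r *\<^sub>R (A * B)"
    by transfer (simp add: matrix_matrix_mult_def vec_eq_iff scaleR_sum_right)
  show "A * r *\<^sub>R B = r *\<^sub>R (A * B)"
    by transfer (simp add: matrix_matrix_mult_def vec_eq_iff scaleR_sum_right)
  show "norm A = 0 \<longleftrightarrow> A = 0"
    by transfer (simp add: onorm_eq_0 matrix_eq)
  show "norm (A + B) \<le> norm A + norm B"
  proof transfer
    fix A B :: "complex^'a^'a"
    have "(*v) (A + B) = (\<lambda>v. A *v v + B *v v)"
      by (simp add: fun_eq_iff matrix_vector_mult_add_rdistrib)
    then show "onorm ((*v) (A + B)) \<le> onorm ((*v) A) + onorm ((*v) B)"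
      by (simp add: onorm_triangle)
  qed
  show "norm (r *\<^sub>R A) = \<bar>r\<bar> * norm A"
  proof transfer
    fix r and A :: "complex^'a^'a"
    have "(*v) (r *\<^sub>R A) = (\<lambda>v. r *\<^sub>R (A *v v))"
      by (simp add: matrix_vector_mult_def vec_eq_iff fun_eq_iff scaleR_sum_right)
    then show "onorm ((*v) (r *\<^sub>R A)) = \<bar>r\<bar> * onorm ((*v) A)"
      by (simp add: onorm_scaleR)
  qed
  show "norm (A * B) \<le> norm A * norm B"
  proof transfer
    fix A B :: "complex^'a^'a"
    have "(*v) (A ** B) = (*v) A \<circ> (*v) B"
      by (simp add: fun_eq_iff matrix_vector_mul_assoc)
    then show "onorm ((*v) (A ** B)) \<le> onorm ((*v) A) * onorm ((*v) B)"
      by (simp add: onorm_compose)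
  qed
  show "norm (1 :: 'a cmat) = 1"
  proof transfer
    have "(*v) (mat 1) = (\<lambda>v :: complex^'a. v)" by auto
    then show "onorm ((*v) (mat 1 :: complex^'a^'a)) = 1" by (simp add: onorm_id)
  qed
qed (rule dist_cmat_def sgn_cmat_def uniformity_cmat_def open_cmat_def | transfer, simp add: algebra_simps)+

end

lemma bounded_linear_cmat_of: "bounded_linear cmat_of"
proof -
  have "linear cmat_of"
    by (intro linearI) (simp_all add: plus_cmat.abs_eq scaleR_cmat.abs_eq)
  then show ?thesis by (simp add: linear_conv_bounded_linear)
qed

text \<open>Entry (i, j) is coordinate i of the image of the unit vector \<open>axis j 1\<close>, so
  the operator norm bounds it. Together with the boundedness of \<open>cmat_of\<close> this carries
  completeness over to \<open>cmat\<close>.\<close>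

lemma bounded_linear_mat_of: "bounded_linear (mat_of :: 'n::finite cmat \<Rightarrow> _)"
proof (rule bounded_linear_intro[where K = "of_nat CARD('n) * of_nat CARD('n)"])
  fix A :: "'n cmat"
  have "norm (mat_of A $ i $ j) \<le> norm A" for i j
  proof -
    have "norm (mat_of A $ i $ j) = norm ((mat_of A *v axis j 1) $ i)"
      by (simp add: matrix_vector_mult_def axis_def if_distrib cong: if_cong)
    also have "\<dots> \<le> norm (mat_of A *v axis j 1)"
      by (rule Finite_Cartesian_Product.norm_nth_le)
    also have "\<dots> \<le> norm A * norm (axis j (1::complex))"
      unfolding norm_cmat.rep_eq by (rule onorm) (simp add:)
    finally show ?thesis by (simp add: norm_axis_1)
  qed
  note e = this
  have "norm (mat_of A) \<le> (\<Sum>i\<in>UNIV. norm (mat_of A $ i))"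
    by (simp add: norm_vec_def L2_set_le_sum)
  also have "\<dots> \<le> (\<Sum>i\<in>UNIV. \<Sum>j\<in>UNIV. norm (mat_of A $ i $ j))"
    by (intro sum_mono) (simp add: norm_vec_def L2_set_le_sum)
  also have "\<dots> \<le> (\<Sum>i\<in>(UNIV::'n set). \<Sum>j\<in>(UNIV::'n set). norm A)"
    by (intro sum_mono e)
  finally show "norm (mat_of A) \<le> norm A * (of_nat CARD('n) * of_nat CARD('n))"
    by (simp add: mult_ac)
qed (simp_all add: plus_cmat.rep_eq scaleR_cmat.rep_eq)

instance cmat :: (finite) banach
proof
  fix X :: "nat \<Rightarrow> 'a cmat"
  assume "Cauchy X"
  then have "Cauchy (\<lambda>n. mat_of (X n))"
    by (rule bounded_linear.Cauchy[OF bounded_linear_mat_of])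
  then obtain L where "(\<lambda>n. mat_of (X n)) \<longlonglongrightarrow> L"
    using Cauchy_convergent convergent_def by blast
  then have "(\<lambda>n. cmat_of (mat_of (X n))) \<longlonglongrightarrow> cmat_of L"
    by (rule bounded_linear.tendsto[OF bounded_linear_cmat_of])
  then show "convergent X"
    unfolding mat_of_inverse convergent_def by blast
qed

section \<open>Scalar matrices and eigenvalues in the matrix algebra\<close>

lemmas if_mult_distrib =
  if_distrib[where f = "\<lambda>x. x * y" for y] if_distrib[where f = "\<lambda>x. y * x" for y]

text \<open>Multiplication by these central elements stands in for complex scaling on an algebra
  whose scalars are real.\<close>

lift_definition cscalar :: "complex \<Rightarrow> 'n::finite cmat" is mat .

lemma cscalar_mult_nth: "mat_of (cscalar a * A) $ i $ j = a * mat_of A $ i $ j"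
  by transfer (simp add: matrix_matrix_mult_def mat_def if_mult_distrib cong: if_cong)

lemma mult_cscalar_nth: "mat_of (A * cscalar a) $ i $ j = a * mat_of A $ i $ j"
  by transfer (simp add: matrix_matrix_mult_def mat_def if_mult_distrib mult.commute cong: if_cong)

lemma cscalar_commute: "A * cscalar a = cscalar a * A"
  by (simp add: vec_eq_iff cscalar_mult_nth mult_cscalar_nth flip: mat_of_inject)

lemma cscalar_left_commute: "A * (cscalar a * B) = cscalar a * (A * B)"
  by (metis cscalar_commute mult.assoc)

lemma cscalar_mult_vec [simp]: "mat_of (cscalar z) *v v = z *s v"
  by transfer (simp add: matrix_vector_mult_def mat_def vec_eq_iff if_mult_distrib cong: if_cong)

lemma cscalar_0 [simp]: "cscalar 0 = 0"
  by transfer (simp add: mat_def vec_eq_iff)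

lemma cscalar_1 [simp]: "cscalar 1 = 1"
  by transfer simp

lemma cscalar_add: "cscalar (a + b) = cscalar a + cscalar b"
  by transfer (simp add: mat_def vec_eq_iff)

lemma cscalar_diff: "cscalar (a - b) = cscalar a - cscalar b"
  by transfer (simp add: mat_def vec_eq_iff)

lemma cscalar_mult: "cscalar (a * b) = cscalar a * cscalar b"
  by transfer (simp add: matrix_matrix_mult_def mat_def vec_eq_iff if_mult_distrib cong: if_cong)

lemma cscalar_scaleR: "cscalar (r *\<^sub>R a) = r *\<^sub>R cscalar a"
  by transfer (simp add: mat_def vec_eq_iff)

lemma cscalar_of_real: "cscalar (of_real r) = r *\<^sub>R 1"
  using cscalar_scaleR[of r 1] by (simp add: of_real_def)

lemma cscalar_eq_0_iff: "cscalar a * A = 0 \<longleftrightarrow> a = 0 \<or> A = 0"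
proof -
  have "cscalar a * A = 0 \<longleftrightarrow> (\<forall>i j. a * mat_of A $ i $ j = 0)"
    by (simp add: vec_eq_iff cscalar_mult_nth zero_cmat.rep_eq flip: mat_of_inject)
  also have "\<dots> \<longleftrightarrow> a = 0 \<or> (\<forall>i j. mat_of A $ i $ j = 0)" by auto
  also have "(\<forall>i j. mat_of A $ i $ j = 0) \<longleftrightarrow> A = 0"
    by (simp add: vec_eq_iff zero_cmat.rep_eq flip: mat_of_inject)
  finally show ?thesis .
qed

lemma exp_cscalar: "exp (cscalar a) = (cscalar (exp a) :: 'n::finite cmat)"
proof -
  have "linear (cscalar :: _ \<Rightarrow> 'n cmat)"
    by (intro linearI cscalar_add cscalar_scaleR)
  then have bl: "bounded_linear (cscalar :: _ \<Rightarrow> 'n cmat)"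
    by (simp add: linear_conv_bounded_linear)
  have "cscalar (a ^ n) = (cscalar a :: 'n cmat) ^ n" for n
    by (induction n) (simp_all add: cscalar_mult)
  then have "(\<lambda>n. (cscalar a :: 'n cmat) ^ n /\<^sub>R fact n) sums cscalar (exp a)"
    using bounded_linear.sums[OF bl exp_converges[of a]] by (simp only: cscalar_scaleR)
  then show ?thesis using exp_converges sums_unique2 by blast
qed

lemma vector_space_cscalar: "vector_space (\<lambda>a A. cscalar a * A)"
  by unfold_locales (simp_all add: distrib_left distrib_right cscalar_add cscalar_mult mult.assoc)

lemma cmat_inverse_or_kernel:
  fixes A :: "'n::finite cmat"
  obtains B where "A * B = 1" "B * A = 1" | v where "v \<noteq> 0" "mat_of A *v v = 0"
proof (cases "\<exists>v. v \<noteq> 0 \<and> mat_of A *v v = 0")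
  case False
  then obtain B where B: "B ** mat_of A = mat 1"
    using matrix_left_invertible_ker[of "mat_of A"] by blast
  then have "mat_of A ** B = mat 1" by (simp add: matrix_left_right_inverse)
  with B have "A * cmat_of B = 1" "cmat_of B * A = 1"
    by (simp_all add: times_cmat.rep_eq one_cmat.rep_eq cmat_of_inverse flip: mat_of_inject)
  then show ?thesis by (rule that(1))
qed (use that(2) in blast)

definition eigenval :: "'n::finite cmat \<Rightarrow> complex \<Rightarrow> bool" where
  "eigenval A z \<longleftrightarrow> (\<exists>v. v \<noteq> 0 \<and> mat_of A *v v = z *s v)"

text \<open>
  Repeating a vector turns the eigenvector equation \<open>A v = z v\<close> into an intertwining
  \<open>A V = V Z\<close> of square matrices, with \<open>Z\<close> the scalar matrix of \<open>z\<close>.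
\<close>

definition repeat_column :: "complex^'n \<Rightarrow> 'n::finite cmat" where
  "repeat_column v = cmat_of (\<chi> i j. v $ i)"

lemma repeat_column_nth [simp]: "mat_of (repeat_column v) $ i $ j = v $ i"
  by (simp add: repeat_column_def cmat_of_inverse)

lemma repeat_column_eq_0_iff: "repeat_column v = 0 \<longleftrightarrow> v = 0"
  by (simp add: vec_eq_iff zero_cmat.rep_eq flip: mat_of_inject)

lemma cmat_mult_column:
  "mat_of (A * Z) $ i $ j = (mat_of A *v (\<chi> k. mat_of Z $ k $ j)) $ i"
  by (simp add: times_cmat.rep_eq matrix_matrix_mult_def matrix_vector_mult_def)

lemma repeat_column_eigen_iff:
  "A * repeat_column v = cscalar z * repeat_column v \<longleftrightarrow> mat_of A *v v = z *s v"
proof -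
  have "(\<chi> k. v $ k) = v" by (simp add: vec_eq_iff)
  then show ?thesis
    by (simp add: vec_eq_iff cmat_mult_column flip: mat_of_inject)
qed

lemma eigenval_leftI:
  assumes "Z \<noteq> 0" "A * Z = cscalar z * Z"
  shows "eigenval A z"
proof -
  obtain i j where "mat_of Z $ i $ j \<noteq> 0"
    using assms(1) by (auto simp: vec_eq_iff zero_cmat.rep_eq simp flip: mat_of_inject)
  then have "(\<chi> k. mat_of Z $ k $ j) \<noteq> 0" by (auto simp: vec_eq_iff)
  moreover have "mat_of A *v (\<chi> k. mat_of Z $ k $ j) = z *s (\<chi> k. mat_of Z $ k $ j)"
    using arg_cong[OF assms(2), of "\<lambda>M. mat_of M $ i $ j" for i]
    by (simp add: vec_eq_iff cmat_mult_column)
  ultimately show ?thesis unfolding eigenval_def by blast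
qed

text \<open>Left and right eigenvalues agree: a nonzero Z with Z (A - z) = 0 rules out an inverse of
  A - z, so A - z has a kernel vector.\<close>

lemma eigenval_rightI:
  assumes "Z \<noteq> 0" "Z * A = Z * cscalar z"
  shows "eigenval A z"
proof (rule cmat_inverse_or_kernel[of "A - cscalar z"])
  fix B assume B: "(A - cscalar z) * B = 1"
  have "Z = Z * ((A - cscalar z) * B)" by (simp add: B)
  also have "\<dots> = (Z * A - Z * cscalar z) * B" by (simp add: algebra_simps)
  finally show ?thesis using assms by simp
next
  fix v assume "v \<noteq> 0" "mat_of (A - cscalar z) *v v = 0"
  then show ?thesis
    by (auto simp: eigenval_def minus_cmat.rep_eq matrix_vector_mult_diff_rdistrib)
qed

subsection \<open>Intertwining matrices\<close>

lemma annihilating_factors_cmat: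
  fixes f :: "'n::finite cmat \<Rightarrow> 'n cmat"
  assumes "\<And>x y. f (x + y) = f x + f y" "\<And>a x. f (cscalar a * x) = cscalar a * f x"
  shows "\<exists>as. fold (\<lambda>a y. f y - cscalar a * y) as x = 0"
proof (rule annihilating_factors[where s = "\<lambda>a A. cscalar a * A"])
  show "linear (mat_of :: 'n cmat \<Rightarrow> _)"
    by (rule bounded_linear.linear[OF bounded_linear_mat_of])
  show "inj (mat_of :: 'n cmat \<Rightarrow> _)"
    by (simp add: inj_def mat_of_inject)
qed (use assms vector_space_cscalar in \<open>auto simp: cscalar_of_real\<close>)

text \<open>The solutions of X y - y Y = w y are stable under left multiplication by X, so a nonzero
  one satisfies X y = a y. Then y Y = (a - w) y, which exhibits w as a - (a - w).\<close>

lemma eigenval_sylvester: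
  assumes Z: "Z \<noteq> 0" "X * Z - Z * Y = cscalar w * Z"
  obtains a b where "eigenval X a" "eigenval Y b" "w = a - b"
proof -
  have lin: "X * (A + B) = X * A + X * B" "X * (cscalar a * A) = cscalar a * (X * A)" for A B a
    by (simp_all add: distrib_left cscalar_left_commute)
  obtain as where as: "fold (\<lambda>a y. X * y - cscalar a * y) as Z = 0"
    using annihilating_factors_cmat[of "\<lambda>y. X * y", OF lin] by blast
  define P where "P = (\<lambda>y. X * y - y * Y = cscalar w * y)"
  have PZ: "P Z" using Z(2) by (simp add: P_def)
  have step: "P (X * y - cscalar a * y)" if "P y" for a y
  proof -
    have "X * (X * y - cscalar a * y) - (X * y - cscalar a * y) * Y =
       X * (X * y - y * Y) - cscalar a * (X * y - y * Y)"
      by (simp add: right_diff_distrib left_diff_distrib mult.assoc lin(2))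
    also have "\<dots> = cscalar w * (X * y) - cscalar (w * a) * y"
      using that by (simp add: P_def lin(2) cscalar_mult mult.commute[of w a] mult.assoc)
    also have "\<dots> = cscalar w * (X * y - cscalar a * y)"
      by (simp add: right_diff_distrib cscalar_mult mult.assoc)
    finally show ?thesis unfolding P_def .
  qed
  obtain a y where y: "y \<noteq> 0" "P y" "X * y = cscalar a * y"
    using eigenvector_in_invariant_set[where P = P and f = "\<lambda>y. X * y" and s = "\<lambda>a y. cscalar a * y",
        OF as Z(1) PZ step] by blast
  have "eigenval X a" by (rule eigenval_leftI[OF y(1,3)])
  moreover have "y * Y = y * cscalar (a - w)"
  proof -
    have "y * Y = X * y - (X * y - y * Y)" by simp
    also have "\<dots> = cscalar a * y - cscalar w * y"
      using y(2,3) by (simp only: P_def)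
    also have "\<dots> = y * cscalar (a - w)"
      by (simp add: cscalar_commute cscalar_diff left_diff_distrib right_diff_distrib)
    finally show ?thesis .
  qed
  then have "eigenval Y (a - w)" by (rule eigenval_rightI[OF y(1)])
  ultimately show ?thesis using that by auto
qed

text \<open>
  Let \<open>T Z = X Z - Z Y\<close>. Peeling one factor \<open>T - a\<close> off a product of such factors that kills
  \<open>Z\<close> leaves \<open>T (T Z) = a (T Z)\<close>. If \<open>a = 0\<close>, then \<open>exp X Z = (Z + T Z) exp Y\<close>; if
  \<open>a \<noteq> 0\<close> and \<open>T Z \<noteq> 0\<close>, then \<open>exp a = 1\<close> although \<open>a\<close> is a difference of
  eigenvalues of \<open>X\<close> and \<open>Y\<close>.
\<close>

lemma exp_intertwine_imp_intertwine:
  fixes X Y Z :: "'n::finite cmat"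
  assumes XY: "\<And>a b. eigenval X a \<Longrightarrow> eigenval Y b \<Longrightarrow> exp a = exp b \<Longrightarrow> a = b"
    and Z: "exp X * Z = Z * exp Y"
  shows "X * Z = Z * Y"
proof -
  define T where "T = (\<lambda>y. X * y - y * Y)"
  have TE: "T y = X * y - y * Y" for y by (simp add: T_def)
  have T: "T (y + z) = T y + T z" "T (cscalar a * y) = cscalar a * T y" for y z a
  proof -
    show "T (cscalar a * y) = cscalar a * T y"
      by (simp add: T_def right_diff_distrib cscalar_left_commute mult.assoc)
  qed (simp add: T_def algebra_simps)
  \<comment> \<open>\<open>T\<close> preserves this relation because X and Y commute with their own
    exponentials.\<close>
  have ET: "exp X * T z = T z * exp Y" if "exp X * z = z * exp Y" for z
  proof -
    have "exp X * T z = X * (exp X * z) - (exp X * z) * Y"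
      by (simp add: T_def right_diff_distrib exp_times_arg_commute flip: mult.assoc)
    also have "\<dots> = X * z * exp Y - z * Y * exp Y"
      using exp_times_arg_commute[of Y] by (simp add: that mult.assoc)
    finally show ?thesis by (simp add: T_def left_diff_distrib)
  qed
  have Yinj: "z = 0" if "z * exp Y = 0" for z
    using arg_cong[OF that, of "\<lambda>u. u * exp (- Y)"] exp_minus_inverse[of Y] by (simp add: mult.assoc)
  have "T y = 0" if "fold (\<lambda>a y. T y - cscalar a * y) as y = 0" "exp X * y = y * exp Y" for as y
    using that
  proof (induction as arbitrary: y)
    case Nil
    then show ?case by (simp add: T_def)
  next
    case (Cons a as)
    define y' where "y' = T y - cscalar a * y"
    have "exp X * y' = y' * exp Y"
    proof -
      have "exp X * (cscalar a * y) = cscalar a * y * exp Y"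
        using Cons.prems(2) by (metis cscalar_commute mult.assoc)
      then show ?thesis
        using ET[OF Cons.prems(2)] by (simp add: y'_def algebra_simps)
    qed
    then have "T y' = 0" using Cons by (simp add: y'_def)
    then have TT: "T (T y) = cscalar a * T y"
      using T(1)[of y' "cscalar a * y"] by (simp add: y'_def T(2))
    show ?case
    proof (cases "a = 0")
      case True
      have "X * y = y * Y + T y" "X * T y = T y * Y"
        using TT True by (auto simp: T_def)
      then have "exp X * y = (y + T y) * exp Y"
        by (rule exp_mult_intertwine_nilpotent)
      then show ?thesis using Cons.prems(2) Yinj by (simp add: distrib_right)
    next
      case False
      \<comment> \<open>Absorbing the eigenvalue a into Y gives exp X (T y) = exp a (T y) exp Y.
        Comparison with \<open>ET\<close> leaves (exp a - 1) (T y) exp Y = 0, and exp Y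
        cancels.\<close>
      have "X * T y = T y * (Y + cscalar a)"
        using TT unfolding TE[of "T y"] cscalar_commute[symmetric] by (simp add: algebra_simps)
      then have "exp X * T y = T y * exp (Y + cscalar a)"
        by (rule exp_mult_intertwine)
      also have "exp (Y + cscalar a) = exp Y * cscalar (exp a)"
        by (simp add: exp_add_commuting cscalar_commute exp_cscalar)
      finally have "cscalar (exp a - 1) * (T y * exp Y) = 0"
        using ET[OF Cons.prems(2)]
        by (simp add: cscalar_diff left_diff_distrib) (metis cscalar_commute mult.assoc)
      then have "exp a = 1 \<or> T y = 0"
        using Yinj by (auto simp: cscalar_eq_0_iff)
      moreover have "exp a \<noteq> 1" if nz: "T y \<noteq> 0"
      proof
        assume "exp a = 1"
        obtain p q where pq: "eigenval X p" "eigenval Y q" "a = p - q"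
          using eigenval_sylvester[OF nz TT[unfolded TE[of "T y"]]] .
        then have "exp p = exp q"
          using \<open>exp a = 1\<close> by (simp add: exp_diff)
        then show False using XY pq False by auto
      qed
      ultimately show ?thesis by blast
    qed
  qed
  moreover obtain as where "fold (\<lambda>a y. T y - cscalar a * y) as Z = 0"
    using annihilating_factors_cmat[of T, OF T] by blast
  ultimately show ?thesis using Z by (auto simp: T_def)
qed

subsection \<open>Complexification of real matrices\<close>

definition complexify :: "real^'n^'n \<Rightarrow> 'n::finite cmat" where
  "complexify A = cmat_of (map_matrix complex_of_real A)"

definition real_part :: "'n::finite cmat \<Rightarrow> real^'n^'n" where
  "real_part Z = map_matrix Re (mat_of Z)"

lemma complexify_nth [simp]: "mat_of (complexify A) $ i $ j = complex_of_real (A $ i $ j)"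
  by (simp add: complexify_def cmat_of_inverse map_matrix_def)

lemma real_part_nth [simp]: "real_part Z $ i $ j = Re (mat_of Z $ i $ j)"
  by (simp add: real_part_def map_matrix_def)

lemma real_part_complexify [simp]: "real_part (complexify A) = A"
  by (simp add: vec_eq_iff)

lemma complexify_inject: "complexify A = complexify B \<longleftrightarrow> A = B"
  by (metis real_part_complexify)

lemma complexify_add: "complexify (A + B) = complexify A + complexify B"
  by (simp add: vec_eq_iff plus_cmat.rep_eq flip: mat_of_inject)

lemma complexify_scaleR: "complexify (r *\<^sub>R A) = r *\<^sub>R complexify A"
  by (simp add: vec_eq_iff scaleR_cmat.rep_eq flip: mat_of_inject) (simp add: scaleR_conv_of_real)

lemma complexify_mult: "complexify (A ** B) = complexify A * complexify B"
  by (simp add: vec_eq_iff times_cmat.rep_eq matrix_matrix_mult_def flip: mat_of_inject)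

lemma complexify_mat_1 [simp]: "complexify (mat 1) = 1"
  by (simp add: vec_eq_iff one_cmat.rep_eq mat_def flip: mat_of_inject)

lemma real_part_1 [simp]: "real_part 1 = mat 1"
  by (metis complexify_mat_1 real_part_complexify)

lemma complexify_matrix_power: "complexify (matrix_power A k) = complexify A ^ k"
  by (induction k) (simp_all add: matrix_power_def complexify_mult)

lemma real_part_complexify_mult: "real_part (complexify A * Z) = A ** real_part Z"
  by (simp add: vec_eq_iff times_cmat.rep_eq matrix_matrix_mult_def)

lemma bounded_linear_complexify: "bounded_linear complexify"
proof -
  have "linear (complexify :: _ \<Rightarrow> 'a cmat)"
    by (intro linearI complexify_add complexify_scaleR)
  then show ?thesis by (simp add: linear_conv_bounded_linear)
qed

lemma bounded_linear_real_part: "bounded_linear real_part"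
proof -
  have "linear (map_matrix Re :: complex^'a^'a \<Rightarrow> _)"
    by (intro linearI) (simp_all add: vec_eq_iff map_matrix_def)
  then have "bounded_linear (map_matrix Re :: complex^'a^'a \<Rightarrow> _)"
    by (simp add: linear_conv_bounded_linear)
  from bounded_linear_compose[OF this bounded_linear_mat_of] show ?thesis
    unfolding real_part_def .
qed

text \<open>Real parts of the convergent complex series show that the series defining
  \<open>matrix_exp\<close> converges, so its \<open>suminf\<close> is a true sum and
  complexification passes through it.\<close>

lemma complexify_matrix_exp: "complexify (matrix_exp A) = exp (complexify A)"
proof -
  let ?e = "\<lambda>k. complexify A ^ k /\<^sub>R fact k"
  have e: "complexify ((1 / fact k) *\<^sub>R matrix_power A k) = ?e k" for k
    by (simp add: complexify_scaleR complexify_matrix_power divide_inverse)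
  have "(\<lambda>k. real_part (?e k)) sums real_part (exp (complexify A))"
    by (intro bounded_linear.sums[OF bounded_linear_real_part] exp_converges)
  then have s: "(\<lambda>k. (1 / fact k) *\<^sub>R matrix_power A k) sums real_part (exp (complexify A))"
    unfolding e[symmetric] by simp
  then have "?e sums complexify (real_part (exp (complexify A)))"
    using bounded_linear.sums[OF bounded_linear_complexify s] by (simp only: e)
  then have "complexify (real_part (exp (complexify A))) = exp (complexify A)"
    using exp_converges sums_unique2 by blast
  moreover have "matrix_exp A = real_part (exp (complexify A))"
    unfolding matrix_exp_def by (rule sums_unique[OF s, symmetric])
  ultimately show ?thesis by simp
qed

lemma complex_eigenspace_iff: "v \<in> complex_eigenspace A z \<longleftrightarrow> mat_of (complexify A) *v v = z *s v"
  by (simp add: complex_eigenspace_def complexify_def cmat_of_inverse)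

lemma complex_eigenvalue_iff: "complex_eigenvalue A z \<longleftrightarrow> eigenval (complexify A) z"
  by (simp add: complex_eigenvalue_def eigenval_def complex_eigenspace_iff)

lemma complex_eigenspace_scaleR:
  assumes "r \<noteq> 0"
  shows "complex_eigenspace (r *\<^sub>R A) (of_real r * z) = complex_eigenspace A z"
proof -
  have "map_matrix complex_of_real (r *\<^sub>R A) *v v = of_real r *s (map_matrix complex_of_real A *v v)" for v
    by (simp add: vec_eq_iff matrix_vector_mult_def map_matrix_def sum_distrib_left mult.assoc)
  moreover have "of_real r *s u = (of_real r * z) *s v \<longleftrightarrow> u = z *s v" for u v :: "complex^'a"
    using assms by (auto simp: vec_eq_iff)
  ultimately show ?thesis
    by (simp add: complex_eigenspace_def)
qed

lemma complex_eigenspace_mat_1_add: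
  "complex_eigenspace (mat 1 + A) (1 + z) = complex_eigenspace A z"
proof -
  have "mat_of (complexify (mat 1 + A)) *v v = v + mat_of (complexify A) *v v" for v
    by (simp add: complexify_add plus_cmat.rep_eq one_cmat.rep_eq matrix_vector_mult_add_rdistrib)
  then show ?thesis
    by (auto simp: complex_eigenspace_iff set_eq_iff vec_eq_iff algebra_simps)
qed

subsection \<open>The principal logarithm\<close>

lemma eigenval_cscalarD: "eigenval (cscalar a) b \<Longrightarrow> b = a"
  by (auto simp: eigenval_def)

text \<open>Two points of the open strip differ in imaginary part by less than 2 pi, so equal
  exponentials force equality there.\<close>

lemma is_principal_log_unique:
  assumes "is_principal_log A X" "is_principal_log A Y"
  shows "X = Y"
proof -
  have "complexify X * 1 = 1 * complexify Y"
  proof (rule exp_intertwine_imp_intertwine)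
    show "exp (complexify X) * 1 = 1 * exp (complexify Y)"
      using assms by (simp add: is_principal_log_def flip: complexify_matrix_exp)
    show "a = b" if "eigenval (complexify X) a" "eigenval (complexify Y) b" "exp a = exp b" for a b
    proof (rule exp_complex_eqI[OF _ that(3)])
      show "\<bar>Im a - Im b\<bar> < 2 * pi"
        using assms that(1,2) unfolding is_principal_log_def complex_eigenvalue_iff by fastforce
    qed
  qed
  then show ?thesis by (simp add: complexify_inject)
qed

text \<open>Intertwining with the scalar matrix of z lifts to exponentials; the strip condition on z
  and on the eigenvalues of X gives the converse.\<close>

lemma complex_eigenspace_principal_log:
  assumes X: "is_principal_log A X" and z: "- pi < Im z" "Im z < pi"
  shows "complex_eigenspace X z = complex_eigenspace A (exp z)"
proof -
  have A: "complexify A = exp (complexify X)"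
    using X by (simp add: is_principal_log_def flip: complexify_matrix_exp)
  have "v \<in> complex_eigenspace X z \<longleftrightarrow> v \<in> complex_eigenspace A (exp z)" for v
  proof -
    let ?V = "repeat_column v :: 'a cmat"
    have "complexify X * ?V = ?V * cscalar z" if "exp (complexify X) * ?V = ?V * exp (cscalar z)"
    proof (rule exp_intertwine_imp_intertwine[OF _ that])
      show "a = b" if "eigenval (complexify X) a" "eigenval (cscalar z :: 'a cmat) b" "exp a = exp b" for a b
      proof (rule exp_complex_eqI[OF _ that(3)])
        show "\<bar>Im a - Im b\<bar> < 2 * pi"
          using X z that(1) eigenval_cscalarD[OF that(2)]
          unfolding is_principal_log_def complex_eigenvalue_iff by fastforce
      qed
    qed
    then have "complexify X * ?V = ?V * cscalar z \<longleftrightarrow> exp (complexify X) * ?V = ?V * exp (cscalar z)"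
      using exp_mult_intertwine by blast
    then show ?thesis
      by (simp add: complex_eigenspace_iff A exp_cscalar cscalar_commute flip: repeat_column_eigen_iff)
  qed
  then show ?thesis by blast
qed

text \<open>The integral logarithm is built over the complex numbers. It remains to see that it is a
  real matrix and that its eigenvalues are real, hence in the strip.\<close>

lemma is_principal_log_exists:
  fixes N :: "real^'n^'n"
  assumes N: "\<And>z. complex_eigenvalue N z \<Longrightarrow> z \<in> \<real> \<and> - 1 < Re z"
  shows "\<exists>X. is_principal_log (mat 1 + N) X"
proof -
  let ?N = "complexify N"
  \<comment> \<open>A kernel vector of 1 + s N would be an eigenvector of N for -1/s <= -1.\<close>
  have "\<exists>R. R * (1 + s *\<^sub>R ?N) = 1 \<and> (1 + s *\<^sub>R ?N) * R = 1" if s: "s \<in> {0..1}" for s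
  proof (rule cmat_inverse_or_kernel[of "1 + s *\<^sub>R ?N"])
    fix v assume v: "v \<noteq> 0" "mat_of (1 + s *\<^sub>R ?N) *v v = 0"
    have "1 + s *\<^sub>R ?N = complexify (mat 1 + s *\<^sub>R N)"
      by (simp add: complexify_add complexify_scaleR)
    with v(2) have "mat_of (complexify (mat 1 + s *\<^sub>R N)) *v v = 0"
      by (simp only:)
    then have "v \<in> complex_eigenspace (mat 1 + s *\<^sub>R N) (1 + (- 1))"
      by (simp add: complex_eigenspace_iff)
    then have *: "v \<in> complex_eigenspace (s *\<^sub>R N) (- 1)"
      by (simp only: complex_eigenspace_mat_1_add)
    have "s \<noteq> 0"
      using * v by (auto simp: complex_eigenspace_def matrix_vector_mult_def map_matrix_def vec_eq_iff)
    then have "v \<in> complex_eigenspace N (of_real (- 1 / s))"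
      using * complex_eigenspace_scaleR[of s N "of_real (- 1 / s)"] by simp
    then have "- 1 < - 1 / s"
      using N[of "of_real (- 1 / s)"] v by (auto simp: complex_eigenvalue_def)
    then show ?thesis using s \<open>s \<noteq> 0\<close> by (simp add: field_simps)
  qed blast
  then obtain R where R: "\<And>s. s \<in> {0..1} \<Longrightarrow> R s * (1 + s *\<^sub>R ?N) = 1"
    "\<And>s. s \<in> {0..1} \<Longrightarrow> (1 + s *\<^sub>R ?N) * R s = 1"
    by metis
  obtain L where L: "((\<lambda>s. ?N * R s) has_integral L) {0..1}" "L * ?N = ?N * L" "exp L = 1 + ?N"
    using exp_integral_log[OF R] by blast
  define X where "X = real_part L"
  \<comment> \<open>The real part of \<open>R s\<close> is again a right inverse of the real matrix
    1 + s N, and inverses are unique.\<close>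
  have R_real: "complexify (real_part (R s)) = R s" if s: "s \<in> {0..1}" for s
  proof -
    have c: "1 + s *\<^sub>R ?N = complexify (mat 1 + s *\<^sub>R N)"
      by (simp add: complexify_add complexify_scaleR)
    have "real_part (complexify (mat 1 + s *\<^sub>R N) * R s) = mat 1"
      using R(2)[OF s] c by simp
    then have "complexify ((mat 1 + s *\<^sub>R N) ** real_part (R s)) = 1"
      unfolding real_part_complexify_mult by simp
    then have "(1 + s *\<^sub>R ?N) * complexify (real_part (R s)) = 1"
      by (simp add: complexify_mult c)
    then show ?thesis
      using R(1)[OF s] by (metis mult.assoc mult_1_left mult_1_right)
  qed
  have L_real: "L = complexify X"
  proof -
    have "((\<lambda>s. complexify (real_part (?N * R s))) has_integral complexify X) {0..1}"
      using has_integral_linear[OF has_integral_linear[OF L(1) bounded_linear_real_part] bounded_linear_complexify]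
      by (simp add: o_def X_def)
    then have "((\<lambda>s. ?N * R s) has_integral complexify X) {0..1}"
      by (rule has_integral_eq[rotated]) (simp add: real_part_complexify_mult complexify_mult R_real)
    with L(1) show ?thesis by (rule has_integral_unique)
  qed
  have "complexify (matrix_exp X) = complexify (mat 1 + N)"
    using L(3) by (simp add: complexify_matrix_exp L_real complexify_add)
  then have "matrix_exp X = mat 1 + N" by (simp add: complexify_inject)
  moreover have "Im z = 0" if z: "complex_eigenvalue X z" for z
  proof -
    obtain v where v: "v \<noteq> 0" "mat_of L *v v = z *s v"
      using z by (auto simp: complex_eigenvalue_iff eigenval_def L_real)
    \<comment> \<open>L and N commute, so this eigenspace of L is stable under N and contains a
      common eigenvector \<open>Z\<close>.\<close>
    define P where "P = (\<lambda>y. L * y = cscalar z * y)"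
    have P: "P (repeat_column v)" "repeat_column v \<noteq> (0 :: 'n cmat)"
      using v by (simp_all add: P_def repeat_column_eigen_iff repeat_column_eq_0_iff)
    obtain as where as: "fold (\<lambda>a y. ?N * y - cscalar a * y) as (repeat_column v) = 0"
      using annihilating_factors_cmat[of "\<lambda>y. ?N * y"] by (auto simp: distrib_left cscalar_left_commute)
    have step: "P (?N * y - cscalar a * y)" if "P y" for a y
    proof -
      have "L * (?N * y) = ?N * (L * y)" by (simp add: L(2) flip: mult.assoc)
      then have "L * (?N * y) = cscalar z * (?N * y)"
        using that by (simp only: P_def cscalar_left_commute[of ?N])
      moreover have "L * (cscalar a * y) = cscalar z * (cscalar a * y)"
        using that unfolding P_def by (metis cscalar_left_commute)
      ultimately show ?thesis by (simp add: P_def right_diff_distrib)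
    qed
    obtain a Z where Z: "Z \<noteq> 0" "L * Z = cscalar z * Z" "?N * Z = cscalar a * Z"
      using eigenvector_in_invariant_set[where P = P and f = "\<lambda>y. ?N * y" and s = "\<lambda>a y. cscalar a * y",
          OF as P(2,1) step] unfolding P_def by blast
    then have "eigenval ?N a" by (intro eigenval_leftI)
    then obtain r where a: "a = of_real r" and r: "- 1 < r"
      using N[of a] by (auto simp: complex_eigenvalue_iff elim!: Reals_cases)
    have NZ: "?N * Z = r *\<^sub>R Z" using Z(3) by (simp add: a cscalar_of_real)
    have pos: "0 < 1 + s * r" if "s \<in> {0..1}" for s
    proof -
      have "- s \<le> s * r" using that r mult_left_mono[of "- 1" r s] by simp
      then show ?thesis using that r by (cases "s = 1") auto
    qed
    have RZ: "?N * R s * Z = (r / (1 + s * r)) *\<^sub>R Z" if s: "s \<in> {0..1}" for s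
    proof -
      have "(1 + s *\<^sub>R ?N) * Z = (1 + s * r) *\<^sub>R Z"
        by (simp add: distrib_right NZ scaleR_left_distrib)
      then have "R s * ((1 + s *\<^sub>R ?N) * Z) = (1 + s * r) *\<^sub>R (R s * Z)" by simp
      then have "Z = (1 + s * r) *\<^sub>R (R s * Z)" using R(1)[OF s] by (simp flip: mult.assoc)
      then have "(1 / (1 + s * r)) *\<^sub>R Z = (1 / (1 + s * r)) *\<^sub>R ((1 + s * r) *\<^sub>R (R s * Z))" by simp
      then have "R s * Z = (1 / (1 + s * r)) *\<^sub>R Z" using pos[OF s] by simp
      then show ?thesis by (simp add: mult.assoc NZ)
    qed
    \<comment> \<open>On \<open>Z\<close> the integrand acts as r / (1 + s r), with antiderivative
      ln (1 + s r). Thus z = ln (1 + r), a real number.\<close>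
    have "((\<lambda>s. r / (1 + s * r)) has_integral ln (1 + 1 * r) - ln (1 + 0 * r)) {0..1}"
      by (rule fundamental_theorem_of_calculus)
        (use pos in \<open>auto intro!: derivative_eq_intros simp flip: has_real_derivative_iff_has_vector_derivative\<close>)
    then have "((\<lambda>s. (r / (1 + s * r)) *\<^sub>R Z) has_integral ln (1 + r) *\<^sub>R Z) {0..1}"
      using has_integral_scaleR_left by force
    then have "((\<lambda>s. ?N * R s * Z) has_integral ln (1 + r) *\<^sub>R Z) {0..1}"
      by (rule has_integral_eq[rotated]) (simp add: RZ)
    moreover have "((\<lambda>s. ?N * R s * Z) has_integral L * Z) {0..1}"
      by (rule has_integral_mult_left[OF L(1)])
    ultimately have "L * Z = ln (1 + r) *\<^sub>R Z" by (rule has_integral_unique[rotated])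
    then have "cscalar (z - of_real (ln (1 + r))) * Z = 0"
      by (simp add: Z(2) cscalar_diff cscalar_of_real left_diff_distrib)
    then have "z = of_real (ln (1 + r))" using Z(1) by (simp add: cscalar_eq_0_iff)
    then show ?thesis by simp
  qed
  ultimately show ?thesis
    using pi_gt_zero unfolding is_principal_log_def by (metis neg_less_0_iff_less)
qed

text \<open>Existence together with uniqueness makes the \<open>THE\<close> in
  \<open>matrix_ln\<close> denote.\<close>

lemma is_principal_log_matrix_ln:
  assumes "is_principal_log A X"
  shows "is_principal_log A (matrix_ln A)"
proof -
  have "\<exists>!X. is_principal_log A X"
    using assms is_principal_log_unique by blast
  then show ?thesis unfolding matrix_ln_def by (rule theI')
qed

subsection \<open>Temporal and aggregate dynamics\<close>

lemma matrix_exp_quasi_idempotent: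
  assumes "M ** M = c *\<^sub>R M" "c \<noteq> 0" "\<tau> \<noteq> 0"
  shows "matrix_exp (\<tau> *\<^sub>R M) = mat 1 + ((exp (c * \<tau>) - 1) / c) *\<^sub>R M"
proof -
  have "complexify (\<tau> *\<^sub>R M) * complexify (\<tau> *\<^sub>R M) = (c * \<tau>) *\<^sub>R complexify (\<tau> *\<^sub>R M)"
    by (simp add: complexify_scaleR assms(1) mult_ac flip: complexify_mult)
  then have "exp (complexify (\<tau> *\<^sub>R M)) =
      1 + ((exp (c * \<tau>) - 1) / (c * \<tau>)) *\<^sub>R complexify (\<tau> *\<^sub>R M)"
    by (rule exp_quasi_idempotent) (use assms in simp)
  also have "\<dots> = complexify (mat 1 + ((exp (c * \<tau>) - 1) / c) *\<^sub>R M)"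
    using assms by (simp add: complexify_add complexify_scaleR)
  finally show ?thesis by (simp add: complexify_inject flip: complexify_matrix_exp)
qed

text \<open>Each exponential is affine in M, so averaging passes through it. Nonemptiness makes the
  mean of the identity matrices the identity.\<close>

lemma mean_matrix_exp:
  fixes MM :: "(real^'n^'n) multiset"
  assumes "MM \<noteq> {#}" "\<forall>M\<in>#MM. M ** M = c *\<^sub>R M" "c \<noteq> 0" "\<tau> \<noteq> 0"
  shows "(1 / real (size MM)) *\<^sub>R (\<Sum>M\<in>#MM. matrix_exp (\<tau> *\<^sub>R M)) =
    mat 1 + ((exp (c * \<tau>) - 1) / c) *\<^sub>R aggregate_matrix MM"
proof -
  have "(\<Sum>M\<in>#MM. matrix_exp (\<tau> *\<^sub>R M)) =
     real (size MM) *\<^sub>R mat 1 + ((exp (c * \<tau>) - 1) / c) *\<^sub>R (\<Sum>M\<in>#MM. M)"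
    using assms(2)
  proof (induction MM)
    case (add M MM)
    then show ?case
      using assms(3,4) by (simp add: matrix_exp_quasi_idempotent scaleR_left_distrib scaleR_right_distrib)
  qed simp
  then show ?thesis
    using assms(1) by (simp add: aggregate_matrix_def scaleR_right_distrib mult.commute)
qed

text \<open>The right-hand side is the chord of \<open>exp\<close> from y to 0. The mean value
  theorem on [y, x] and on [x, 0] compares the slopes on the two sides of x.\<close>

lemma exp_chord_less:
  fixes x y :: real
  assumes "y < x" "x < 0"
  shows "exp x < 1 + (exp y - 1) / y * x"
proof -
  have "\<exists>z>x. z < 0 \<and> exp 0 - exp x = (0 - x) * exp z"
    using assms by (intro MVT2) (auto intro!: derivative_eq_intros)
  then obtain p where p: "x < p" "1 - exp x = - x * exp p" by auto
  have "\<exists>z>y. z < x \<and> exp x - exp y = (x - y) * exp z"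
    using assms by (intro MVT2) (auto intro!: derivative_eq_intros)
  then obtain q where q: "q < x" "exp x - exp y = (x - y) * exp q" by auto
  have "(x - y) * exp q * (- x) < (x - y) * exp p * (- x)"
    using p q assms by (intro mult_strict_right_mono mult_strict_left_mono) auto
  then have "(exp x - exp y) * (- x) < (x - y) * (1 - exp x)"
    using p q by (simp add: mult_ac)
  then have "y * exp x > y + (exp y - 1) * x"
    by (simp add: algebra_simps)
  then show ?thesis using assms by (simp add: field_simps)
qed

text \<open>Since ln 1 = 0, the eigenvalue is the difference quotient at 0 of a function whose
  derivative there is (c / c) \<mu>.\<close>

lemma temporal_eigenvalue_tendsto:
  assumes "c \<noteq> 0"
  shows "((\<lambda>\<tau>. temporal_eigenvalue c \<tau> \<mu>) \<longlongrightarrow> \<mu>) (at_right 0)"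
proof -
  have "((\<lambda>\<tau>. ln (1 + (exp (c * \<tau>) - 1) / c * \<mu>)) has_real_derivative \<mu>) (at 0)"
    using assms by (auto intro!: derivative_eq_intros)
  then have "((\<lambda>\<tau>. ln (1 + (exp (c * \<tau>) - 1) / c * \<mu>) / \<tau>) \<longlongrightarrow> \<mu>) (at 0)"
    by (simp add: DERIV_def)
  then have "((\<lambda>\<tau>. ln (1 + (exp (c * \<tau>) - 1) / c * \<mu>) / \<tau>) \<longlongrightarrow> \<mu>) (at_right 0)"
    by (rule tendsto_mono[OF at_le[OF subset_UNIV]])
  then show ?thesis
    by (simp add: temporal_eigenvalue_def)
qed

text \<open>At \<mu> = c the averaged propagator has eigenvalue exp (c \<tau>), whose logarithm
  divided by \<tau> is c again. The inequality is therefore strict only for c < \<mu>, and the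
  endpoint is stated as an equality.\<close>

theorem theorem4p3:
  fixes MM :: "(real^'n^'n) multiset" and c :: real
  assumes "MM \<noteq> {#}"
    and "c < 0"
    and "\<forall>M\<in>#MM. M ** M = c *\<^sub>R M"
    and "\<forall>z. complex_eigenvalue (aggregate_matrix MM) z \<longrightarrow> z \<in> \<real> \<and> c \<le> Re z \<and> Re z < 0"
  shows
    "(\<forall>\<tau>>0.
        (\<forall>z. complex_eigenvalue (temporal_matrix \<tau> MM) z \<longleftrightarrow>
           (\<exists>\<mu>. complex_eigenvalue (aggregate_matrix MM) (complex_of_real \<mu>) \<and>
                z = complex_of_real (temporal_eigenvalue c \<tau> \<mu>))) \<and>
        (\<forall>\<mu>. complex_eigenvalue (aggregate_matrix MM) (complex_of_real \<mu>) \<longrightarrow>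
           complex_eigenspace (temporal_matrix \<tau> MM) (complex_of_real (temporal_eigenvalue c \<tau> \<mu>))
             = complex_eigenspace (aggregate_matrix MM) (complex_of_real \<mu>) \<and>
           (c < \<mu> \<longrightarrow> \<mu> < temporal_eigenvalue c \<tau> \<mu>) \<and>
           (\<mu> = c \<longrightarrow> temporal_eigenvalue c \<tau> \<mu> = \<mu>))) \<and>
     (\<forall>\<mu>. complex_eigenvalue (aggregate_matrix MM) (complex_of_real \<mu>) \<longrightarrow>
        ((\<lambda>\<tau>. temporal_eigenvalue c \<tau> \<mu>) \<longlongrightarrow> \<mu>) (at_right 0))"
proof -
  define A where "A = aggregate_matrix MM"
  have c: "c \<noteq> 0" using assms(2) by simp
  have ev: "z \<in> \<real> \<and> c \<le> Re z \<and> Re z < 0" if "complex_eigenvalue A z" for z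
    using assms(4) that by (simp add: A_def)
  have main: "(\<forall>z. complex_eigenvalue (temporal_matrix \<tau> MM) z \<longleftrightarrow>
           (\<exists>\<mu>. complex_eigenvalue A (complex_of_real \<mu>) \<and>
                z = complex_of_real (temporal_eigenvalue c \<tau> \<mu>))) \<and>
        (\<forall>\<mu>. complex_eigenvalue A (complex_of_real \<mu>) \<longrightarrow>
           complex_eigenspace (temporal_matrix \<tau> MM) (complex_of_real (temporal_eigenvalue c \<tau> \<mu>))
             = complex_eigenspace A (complex_of_real \<mu>) \<and>
           (c < \<mu> \<longrightarrow> \<mu> < temporal_eigenvalue c \<tau> \<mu>) \<and>
           (\<mu> = c \<longrightarrow> temporal_eigenvalue c \<tau> \<mu> = \<mu>))" if \<tau>: "\<tau> > 0" for \<tau>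
  proof -
    define k where "k = (exp (c * \<tau>) - 1) / c"
    have "c * \<tau> < 0" using assms(2) \<tau> by (simp add: mult_neg_pos)
    then have k: "k > 0" using assms(2) by (simp add: k_def divide_neg_neg)
    have kc: "k * c = exp (c * \<tau>) - 1" using c by (simp add: k_def)
    \<comment> \<open>The smallest value, at \<mu> = c, is exp (c \<tau>).\<close>
    have pos: "0 < 1 + k * \<mu>" if "c \<le> \<mu>" for \<mu>
    proof -
      have "k * c \<le> k * \<mu>" using that k by simp
      then show ?thesis using kc exp_gt_zero[of "c * \<tau>"] by linarith
    qed
    define B where "B = mat 1 + k *\<^sub>R A"
    have scaled: "complex_eigenspace (k *\<^sub>R A) (of_real k * z) = complex_eigenspace A z" for z
      by (rule complex_eigenspace_scaleR) (use k in simp)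
    have "\<exists>X. is_principal_log B X"
      unfolding B_def
    proof (rule is_principal_log_exists)
      fix z assume "complex_eigenvalue (k *\<^sub>R A) z"
      then have "complex_eigenvalue A (z / of_real k)"
        using scaled[of "z / of_real k"] k by (simp add: complex_eigenvalue_def)
      then have r: "z / of_real k \<in> \<real>" "c \<le> Re z / k" using ev by fastforce+
      have "z = of_real k * (z / of_real k)" using k by simp
      then have "z \<in> \<real>" using r(1) Reals_mult Reals_of_real by metis
      moreover have "- 1 < Re z" using pos[OF r(2)] k by simp
      ultimately show "z \<in> \<real> \<and> - 1 < Re z" ..
    qed
    then have X: "is_principal_log B (matrix_ln B)" using is_principal_log_matrix_ln by blast
    have T: "temporal_matrix \<tau> MM = (1 / \<tau>) *\<^sub>R matrix_ln B"
      using mean_matrix_exp[OF assms(1,3) c, of \<tau>] \<tau> by (simp add: temporal_matrix_def B_def A_def k_def)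
    have T_ln: "complex_eigenspace (temporal_matrix \<tau> MM) z = complex_eigenspace (matrix_ln B) (of_real \<tau> * z)" for z
      using complex_eigenspace_scaleR[of "1 / \<tau>" "matrix_ln B" "of_real \<tau> * z"] \<tau> by (simp add: T)
    \<comment> \<open>Three changes of spectral variable are composed: scaling by \<tau>, the
      exponential on the strip, and the affine map w to 1 + k w.\<close>
    have T_A: "complex_eigenspace (temporal_matrix \<tau> MM) z = complex_eigenspace A w"
      if "- pi < Im (of_real \<tau> * z)" "Im (of_real \<tau> * z) < pi" "exp (of_real \<tau> * z) = 1 + of_real k * w" for z w
      using complex_eigenspace_principal_log[OF X that(1,2)] that(3)
      by (simp add: T_ln B_def complex_eigenspace_mat_1_add scaled)
    have te: "\<tau> * temporal_eigenvalue c \<tau> \<mu> = ln (1 + k * \<mu>)" for \<mu>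
      using \<tau> by (simp add: temporal_eigenvalue_def k_def)
    have exp_te: "exp (of_real \<tau> * of_real (temporal_eigenvalue c \<tau> \<mu>)) = 1 + complex_of_real k * of_real \<mu>"
      if "c \<le> \<mu>" for \<mu>
    proof -
      have "exp (\<tau> * temporal_eigenvalue c \<tau> \<mu>) = 1 + k * \<mu>"
        unfolding te using pos[OF that] by simp
      from arg_cong[OF this, of complex_of_real] show ?thesis by (simp add: exp_of_real[symmetric])
    qed
    have space: "complex_eigenspace (temporal_matrix \<tau> MM) (of_real (temporal_eigenvalue c \<tau> \<mu>)) =
        complex_eigenspace A (of_real \<mu>)" if "c \<le> \<mu>" for \<mu>
      by (rule T_A) (use exp_te[OF that] in simp_all)
    have "\<exists>\<mu>. complex_eigenvalue A (of_real \<mu>) \<and> z = of_real (temporal_eigenvalue c \<tau> \<mu>)"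
      if z: "complex_eigenvalue (temporal_matrix \<tau> MM) z" for z
    proof -
      have "complex_eigenvalue (matrix_ln B) (of_real \<tau> * z)"
        using z by (simp add: complex_eigenvalue_def T_ln)
      then have Im: "- pi < Im (of_real \<tau> * z)" "Im (of_real \<tau> * z) < pi"
        using X unfolding is_principal_log_def by blast+
      \<comment> \<open>The only candidate for an eigenvalue of \<open>A\<close> that produces z.
        Once w is known to be real, injectivity of \<open>exp\<close> on the strip recovers
        z.\<close>
      define w where "w = (exp (of_real \<tau> * z) - 1) / of_real k"
      have w: "exp (of_real \<tau> * z) = 1 + of_real k * w" using k by (simp add: w_def)
      have "complex_eigenvalue A w"
        using z T_A[OF Im w] by (simp add: complex_eigenvalue_def)
      then obtain \<mu> where \<mu>: "w = of_real \<mu>" "c \<le> \<mu>" "complex_eigenvalue A (of_real \<mu>)"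
        using ev[of w] by (auto elim!: Reals_cases)
      have "of_real \<tau> * z = of_real \<tau> * of_real (temporal_eigenvalue c \<tau> \<mu>)"
        by (rule exp_complex_eqI) (use Im w \<mu>(1) exp_te[OF \<mu>(2)] in auto)
      then show ?thesis using \<tau> \<mu>(3) by auto
    qed
    moreover have "complex_eigenvalue (temporal_matrix \<tau> MM) (of_real (temporal_eigenvalue c \<tau> \<mu>))"
      if "complex_eigenvalue A (of_real \<mu>)" for \<mu>
      using that space[of \<mu>] ev[OF that] by (simp add: complex_eigenvalue_def)
    moreover have "\<mu> < temporal_eigenvalue c \<tau> \<mu>" if \<mu>: "c < \<mu>" "\<mu> < 0" for \<mu>
    proof -
      \<comment> \<open>The chord inequality with x = \<tau> \<mu> and y = c \<tau>.\<close>
      have "exp (\<tau> * \<mu>) < 1 + (exp (c * \<tau>) - 1) / (c * \<tau>) * (\<tau> * \<mu>)"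
        by (rule exp_chord_less) (use \<mu> \<tau> in \<open>simp_all add: mult.commute mult_neg_pos\<close>)
      also have "\<dots> = 1 + k * \<mu>" using \<tau> by (simp add: k_def)
      finally have "\<tau> * \<mu> < ln (1 + k * \<mu>)"
        using pos[of \<mu>] \<mu> by (metis exp_gt_zero less_imp_le ln_exp ln_less_cancel_iff)
      then show ?thesis using \<tau> by (simp flip: te)
    qed
    moreover have "temporal_eigenvalue c \<tau> c = c"
      using \<tau> c by (simp add: temporal_eigenvalue_def)
    ultimately show ?thesis using space ev by fastforce
  qed
  show ?thesis
    using main temporal_eigenvalue_tendsto[OF c] unfolding A_def by blast
qed

end
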